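(* There exists a bijection $f:(0,\infty)\to(0,\infty)$ which is subadditive, i.e. $f(x+y)\le f(x)+f(y)$ for all $x,y>0$, and such that $$\liminf_{x\to 0}f(x)=0\qquad\text{and}\qquad \limsup_{x\to 0}f(x)=1.$$
   Context: Since $f$ is defined on $(0,\infty)$, the limits inferior and superior as $x\to 0$ are taken over $x>0$. *)

theory Defs
  imports "HOL-Analysis.Analysis"
begin

end

theory Submission
  imports Defs
begin

text \<open>
  Let \<open>\<phi> : \<real> \<rightarrow> \<rat>\<close> be additive with all fibres dense and \<open>\<phi> 1 = 0\<close>; it comes from a basis of the
  reals over the rationals. The function is \<open>f x = x + shift x\<close>, where the size of the shift is
  governed by the position of \<open>\<phi> x\<close> in the filtration
  \<open>\<rat> \<supseteq> \<int> \<supseteq> 2\<int> \<supseteq> 4\<int> \<supseteq> \<dots>\<close>: it is 0 if \<open>\<phi> x = 0\<close>, it is 1 if \<open>\<phi> x\<close> is not an integer, and on the layer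
  of the \<open>x\<close> with \<open>\<phi> x\<close> in \<open>2\<^sup>n\<int> - 2\<^sup>n\<^sup>+\<^sup>1\<int>\<close> it takes two values, a larger one \<open>p\<close> for small \<open>x\<close> and then a
  smaller one \<open>q \<ge> p / 2\<close>, with \<open>p\<close> decreasing to 0 along the layers. The two limits follow at once:
  near 0 there are points with \<open>\<phi> x = 0\<close>, where \<open>f x = x\<close>, and points with \<open>\<phi> x = 1/2\<close>, where
  \<open>f x = x + 1\<close>, and no shift exceeds 1.

  Subadditivity amounts to that of the shift, and uses that the filtration consists of subgroups. Count
  the points with \<open>\<phi> x \<notin> \<int>\<close> as the first layer and those with \<open>\<phi> x = 0\<close> as the last one. If
  \<open>x\<close> lies in an earlier layer than \<open>y\<close>, then \<open>x + y\<close> is in the layer of \<open>x\<close> and to the right of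
  \<open>x\<close>, where the shift is no larger. If both are in the same layer, then \<open>x + y\<close> is in this layer or
  a later one, so that its shift is at most \<open>p \<le> q + q\<close>; on the first layer \<open>p = q = 1\<close>.

  For bijectivity the parameters are chosen in stages (lemma \<open>stages_exist\<close>). The set \<open>\<phi> x \<notin> \<int>\<close> is
  moved by 1 and covers the part above 1 of the target points with \<open>\<phi> y \<notin> \<int>\<close>. In general,
  after \<open>n\<close> stages the points \<open>y\<close> with \<open>\<phi> y \<notin> 2\<^sup>n\<int>\<close> are covered, once each, exactly above a threshold
  that depends only on the class of \<open>\<phi> y\<close> modulo \<open>2\<^sup>n\<int>\<close>. The next layer is itself a single
  class modulo \<open>2\<^sup>n\<^sup>+\<^sup>1\<int>\<close>. Its initial part is moved by \<open>p\<close> into another class, prescribed as the task of this stage,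
  and fills the gap between \<open>p\<close> and the old threshold there; this is possible because
  \<open>\<phi> p\<close> can be prescribed while \<open>p\<close> is as small as desired. Once the gap is filled, the shift drops to
  \<open>q\<close> with \<open>\<phi> q = 0\<close>, and the rest of the layer covers an upper part of the layer itself, which
  was untouched so far. Lemma \<open>bij_betw_f_stage\<close> is this induction. Every nonzero rational is
  the task of infinitely many stages, so all thresholds tend to 0 and every \<open>y > 0\<close> with \<open>\<phi> y \<noteq> 0\<close>
  is covered; the points with \<open>\<phi> y = 0\<close> are fixed.
\<close>

section \<open>A rational-valued additive functional with dense fibres\<close>

text \<open>
  A rational-linear \<open>g\<close> with \<open>g 1 = 1\<close> is the identity on the rationals, so any irrational number
  yields a nonzero \<open>\<kappa>\<close> in its kernel. Then \<open>x \<mapsto> g (\<kappa> x)\<close> vanishes on all rationals and maps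
  \<open>v / \<kappa>\<close> to \<open>v\<close>; its fibres are therefore dense, being invariant under rational translations.
\<close>

lemma additive_functional_exists:
  "\<exists>\<phi> :: real \<Rightarrow> rat. (\<forall>x y. \<phi> (x + y) = \<phi> x + \<phi> y) \<and> \<phi> 1 = 0 \<and>
     (\<forall>v l r. l < r \<longrightarrow> (\<exists>x. l < x \<and> x < r \<and> \<phi> x = v))"
proof -
  interpret Q: vector_space_pair "\<lambda>(c::rat) (x::real). of_rat c * x" "\<lambda>(c::rat) (x::rat). c * x"
    by unfold_locales (simp_all add: algebra_simps of_rat_add of_rat_mult)
  have "\<not> Q.vs1.dependent {1::real}" by simp
  from Q.linear_independent_extend[OF this, of "\<lambda>_. 1"]
  obtain g where g: "Vector_Spaces.linear (\<lambda>(c::rat) (x::real). of_rat c * x) (\<lambda>(c::rat) (x::rat). c * x) g"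
    and g1: "g 1 = 1" by auto
  have gadd: "g (x + y) = g x + g y" and gscale: "g (of_rat c * x) = c * g x" for x y c
    using Q.linear_add[OF g] Q.linear_scale[OF g] by auto
  have grat: "g (of_rat c) = c" for c
    using gscale[of c 1] g1 by simp
  obtain z :: real where z: "z \<notin> \<rat>"
    using uncountable_UNIV_real countable_rat by (metis UNIV_eq_I)
  define \<kappa> where "\<kappa> = z - of_rat (g z)"
  have k0: "\<kappa> \<noteq> 0"
    using z unfolding \<kappa>_def by (metis Rats_of_rat eq_iff_diff_eq_0)
  have "g \<kappa> + g (of_rat (g z)) = g z"
    unfolding \<kappa>_def gadd[symmetric] by simp
  then have gk: "g \<kappa> = 0" by (simp add: grat)
  define \<phi> where "\<phi> x = g (\<kappa> * x)" for x
  have dense: "\<exists>x. l < x \<and> x < r \<and> \<phi> x = v" if "l < r" for v l r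
  proof -
    obtain c where c: "l - of_rat v / \<kappa> < real_of_rat c" "real_of_rat c < r - of_rat v / \<kappa>"
      using of_rat_dense[of "l - of_rat v / \<kappa>" "r - of_rat v / \<kappa>"] \<open>l < r\<close> by auto
    have "\<kappa> * (of_rat c + of_rat v / \<kappa>) = of_rat c * \<kappa> + of_rat v"
      using k0 by (simp add: field_simps)
    then have "\<phi> (of_rat c + of_rat v / \<kappa>) = v"
      unfolding \<phi>_def by (simp add: gadd gscale gk grat)
    with c show ?thesis by (intro exI[of _ "of_rat c + of_rat v / \<kappa>"]) auto
  qed
  show ?thesis
    by (rule exI[of _ \<phi>]) (use dense gk in \<open>auto simp: \<phi>_def gadd distrib_left\<close>)
qed

section \<open>The 2-adic filtration of the rationals\<close>

definition pow2Z :: "nat \<Rightarrow> rat set"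
  where "pow2Z n = {v. v / 2 ^ n \<in> \<int>}"

lemma pow2Z_add: "v \<in> pow2Z n \<Longrightarrow> w \<in> pow2Z n \<Longrightarrow> v + w \<in> pow2Z n"
  by (simp add: pow2Z_def add_divide_distrib)

lemma pow2Z_diff: "v \<in> pow2Z n \<Longrightarrow> w \<in> pow2Z n \<Longrightarrow> v - w \<in> pow2Z n"
  by (simp add: pow2Z_def diff_divide_distrib)

lemma pow2Z_cong: "v - w \<in> pow2Z n \<Longrightarrow> v \<in> pow2Z n \<longleftrightarrow> w \<in> pow2Z n"
  using pow2Z_add[of "v - w" n w] pow2Z_diff[of v n "v - w"] by auto

lemma zero_in_pow2Z: "0 \<in> pow2Z n"
  by (simp add: pow2Z_def)

lemma pow2Z_Suc_subset: "v \<in> pow2Z (Suc n) \<Longrightarrow> v \<in> pow2Z n"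
proof -
  assume "v \<in> pow2Z (Suc n)"
  then have "2 * (v / 2 ^ Suc n) \<in> \<int>" unfolding pow2Z_def by (intro Ints_mult) auto
  then show ?thesis by (simp add: pow2Z_def)
qed

lemma pow2Z_antimono: "m \<le> n \<Longrightarrow> v \<in> pow2Z n \<Longrightarrow> v \<in> pow2Z m"
  by (induction n rule: dec_induct) (auto dest: pow2Z_Suc_subset)

lemma half_notin_pow2Z: "1 / 2 \<notin> pow2Z n"
proof
  assume "1 / 2 \<in> pow2Z n"
  then have "1 / 2 \<in> pow2Z 0" by (rule pow2Z_antimono[rotated]) simp
  then obtain m :: int where "(1 / 2 :: rat) = of_int m" by (auto simp: pow2Z_def elim: Ints_cases)
  then have "(1 :: rat) = of_int (2 * m)" by (simp add: field_simps)
  then have "1 = 2 * m" by (metis of_int_eq_iff of_int_1)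
  then show False by presburger
qed

text \<open>A layer of the filtration is a single coset of the next subgroup: the odd multiples of \<open>2\<^sup>n\<close>.\<close>

lemma pow2Z_layer_iff: "v \<in> pow2Z n \<and> v \<notin> pow2Z (Suc n) \<longleftrightarrow> v - 2 ^ n \<in> pow2Z (Suc n)"
proof -
  have *: "(v - 2 ^ n) / 2 ^ Suc n = (v / 2 ^ n - 1) / 2" "v / 2 ^ Suc n = (v / 2 ^ n) / 2"
    by (simp_all add: field_simps)
  have "u \<in> \<int> \<and> u / 2 \<notin> \<int> \<longleftrightarrow> (u - 1) / 2 \<in> \<int>" for u :: rat
  proof
    assume u: "u \<in> \<int> \<and> u / 2 \<notin> \<int>"
    then obtain m :: int where m: "u = of_int m" by (auto elim: Ints_cases)
    have "odd m"
    proof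
      assume "even m"
      then obtain j where "m = 2 * j" by (elim evenE)
      then have "u / 2 = of_int j" using m by simp
      with u show False by simp
    qed
    then obtain j where "m = 2 * j + 1" by (elim oddE)
    then have "(u - 1) / 2 = of_int j" using m by simp
    then show "(u - 1) / 2 \<in> \<int>" by simp
  next
    assume "(u - 1) / 2 \<in> \<int>"
    then obtain j :: int where j: "(u - 1) / 2 = of_int j" by (auto elim: Ints_cases)
    then have u: "u = of_int (2 * j + 1)" by (simp add: field_simps)
    have "u / 2 \<notin> \<int>"
    proof
      assume "u / 2 \<in> \<int>"
      then obtain i :: int where "u / 2 = of_int i" by (auto elim: Ints_cases)
      then have "u = of_int (2 * i)" by (simp add: field_simps)
      with u have "2 * j + 1 = 2 * i" by (metis of_int_eq_iff)
      then show False by presburger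
    qed
    with u show "u \<in> \<int> \<and> u / 2 \<notin> \<int>" by (metis Ints_of_int)
  qed
  then show ?thesis unfolding pow2Z_def mem_Collect_eq * .
qed

lemma nonzero_leaves_pow2Z: "v \<noteq> 0 \<Longrightarrow> \<exists>n. v \<notin> pow2Z n"
proof (rule ccontr)
  assume v: "v \<noteq> 0" and "\<nexists>n. v \<notin> pow2Z n"
  then have "v / 2 ^ n \<in> \<int>" for n by (auto simp: pow2Z_def)
  then have "1 \<le> \<bar>v / 2 ^ n\<bar>" for n using v by (intro Ints_nonzero_abs_ge1) auto
  then have ge: "2 ^ n \<le> \<bar>v\<bar>" for n by (simp add: abs_divide field_simps)
  obtain n where "\<bar>v\<bar> < of_nat n" using reals_Archimedean2 by blast
  moreover have "(of_nat n :: rat) < 2 ^ n" by (rule of_nat_less_two_power)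
  ultimately show False using ge[of n] by linarith
qed

text \<open>
  Nonintegers have level 0 and the integers \<open>v \<noteq> 0\<close> have their 2-adic valuation plus 1; the value
  at 0 is unspecified, as no subgroup omits 0.
\<close>

definition level :: "rat \<Rightarrow> nat"
  where "level v = (LEAST n. v \<notin> pow2Z n)"

lemma level_le_iff: "v \<noteq> 0 \<Longrightarrow> level v \<le> n \<longleftrightarrow> v \<notin> pow2Z n"
  by (metis pow2Z_antimono LeastI_ex Least_le level_def nonzero_leaves_pow2Z)

lemma level_eq_Suc: "v - 2 ^ n \<in> pow2Z (Suc n) \<Longrightarrow> v \<noteq> 0 \<and> level v = Suc n"
  by (metis pow2Z_layer_iff level_le_iff not_less_eq_eq le_antisym zero_in_pow2Z)

lemma level_sum_ge:
  assumes "v \<noteq> 0" "w \<noteq> 0" "v + w \<noteq> 0" "level v \<le> level w"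
  shows "level v \<le> level (v + w)"
proof (rule ccontr)
  assume "\<not> ?thesis"
  then have "\<not> level v \<le> level (v + w)" "\<not> level w \<le> level (v + w)" using assms by linarith+
  then have "v \<in> pow2Z (level (v + w))" "w \<in> pow2Z (level (v + w))"
    using level_le_iff[OF assms(1)] level_le_iff[OF assms(2)] by blast+
  then have "v + w \<in> pow2Z (level (v + w))" by (rule pow2Z_add)
  then show False using level_le_iff[of "v + w" "level (v + w)"] assms by simp
qed

lemma level_sum_eq:
  assumes "v \<noteq> 0" "w \<noteq> 0" "level v < level w"
  shows "v + w \<noteq> 0 \<and> level (v + w) = level v"
proof -
  have w: "w \<in> pow2Z (level v)" using assms level_le_iff by (metis not_le)
  have v: "v \<notin> pow2Z (level v)" using assms level_le_iff by blast
  have "v + w \<notin> pow2Z (level v)" using w v pow2Z_cong[of "v + w" v] by simp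
  moreover from this have "v + w \<noteq> 0" using zero_in_pow2Z by metis
  ultimately show ?thesis using level_sum_ge[of v w] assms level_le_iff[of "v + w" "level v"] by force
qed


section \<open>The staged construction\<close>

text \<open>
  The second component of the decoded pair lets every rational recur infinitely often. A stage
  can only work on a class that has been covered in part already, that is, outside
  \<open>2\<^sup>n\<int>\<close>; if the rational on turn is not of this kind, the harmless class of \<open>1 / 2\<close> takes its place.
\<close>

definition task :: "nat \<Rightarrow> rat"
  where "task n = (let v = from_nat (fst (prod_decode n)) in if v \<in> pow2Z n then 1 / 2 else v)"

lemma task_notin_pow2Z: "task n \<notin> pow2Z n"
  by (simp add: task_def Let_def half_notin_pow2Z)

lemma task_recurs:
  assumes "v \<noteq> 0"
  shows "\<exists>n\<ge>N. task n = v"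
proof -
  obtain m where m: "v \<notin> pow2Z m" using nonzero_leaves_pow2Z assms by blast
  define n where "n = prod_encode (to_nat v, max m N)"
  have "max m N \<le> n" unfolding n_def by (rule le_prod_encode_2)
  moreover from this have "v \<notin> pow2Z n" using m pow2Z_antimono by (meson max.boundedE)
  ultimately show ?thesis by (intro exI[of _ n]) (simp add: task_def Let_def n_def)
qed

text \<open>
  On the layer of level \<open>n\<close> the shift will be \<open>p n\<close> up to \<open>a n\<close> and \<open>q n\<close> beyond. The number \<open>b n v\<close> is the
  threshold above which the points \<open>y\<close> with \<open>\<phi> y = v\<close> are covered by the levels up to \<open>n\<close>;
  it is meaningful for \<open>v \<notin> 2\<^sup>n\<int>\<close> only. The equation for \<open>a (Suc n)\<close> says that the image of the initial
  part of the layer ends exactly at the old threshold of the task.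
\<close>

locale stages =
  fixes \<phi> :: "real \<Rightarrow> rat" and p q a :: "nat \<Rightarrow> real" and b :: "nat \<Rightarrow> rat \<Rightarrow> real"
  assumes add: "\<phi> (x + y) = \<phi> x + \<phi> y"
    and dense: "l < r \<Longrightarrow> \<exists>x. l < x \<and> x < r \<and> \<phi> x = v"
    and p0: "p 0 = 1" and q0: "q 0 = 1" and b0: "b 0 v = 1" and \<phi>_q: "\<phi> (q n) = 0"
    and \<phi>_p: "\<phi> (p (Suc n)) = task n - 2 ^ n"
    and p_pos: "0 < p n" and p_le: "p (Suc n) \<le> p n" and p_small: "p (Suc n) < 1 / Suc n"
    and p_less: "p (Suc n) < b n (task n)"
    and q_le: "q n \<le> p n" and q_ge: "p n \<le> 2 * q n"
    and a_Suc: "a (Suc n) = b n (task n) - p (Suc n)"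
    and b_Suc: "b (Suc n) v =
      (if v - task n \<in> pow2Z (Suc n) then p (Suc n)
       else if v - 2 ^ n \<in> pow2Z (Suc n) then a (Suc n) + q (Suc n) else b n v)"

text \<open>
  Density of the fibres of \<open>\<phi>\<close> permits to prescribe \<open>\<phi> p\<close> and \<open>\<phi> q\<close> together with arbitrary
  open intervals for \<open>p\<close> and \<open>q\<close>. Positivity of all thresholds leaves room for the next \<open>p\<close>.
\<close>

lemma stages_exist:
  assumes add: "\<And>x y. \<phi> (x + y) = \<phi> x + (\<phi> y :: rat)" and one: "\<phi> 1 = 0"
    and dense: "\<And>v l r. l < r \<Longrightarrow> \<exists>x. l < x \<and> x < r \<and> \<phi> x = v"
  shows "\<exists>p q a b. stages \<phi> p q a b"
proof -
  define P where "P n st = (case st of (p, q, a, b) \<Rightarrow>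
      0 < p \<and> q \<le> p \<and> p \<le> 2 * q \<and> \<phi> q = 0 \<and> (\<forall>v. 0 < b v) \<and> (n = 0 \<longrightarrow> p = 1 \<and> q = 1 \<and> (\<forall>v. b v = 1)))"
    for n :: nat and st :: "real \<times> real \<times> real \<times> (rat \<Rightarrow> real)"
  define R where "R n st st' = (case st of (p, q, a, b) \<Rightarrow> case st' of (p', q', a', b') \<Rightarrow>
      \<phi> p' = task n - 2 ^ n \<and> p' \<le> p \<and> p' < 1 / Suc n \<and> p' < b (task n) \<and> a' = b (task n) - p' \<and>
      b' = (\<lambda>v. if v - task n \<in> pow2Z (Suc n) then p'
        else if v - 2 ^ n \<in> pow2Z (Suc n) then a' + q' else b v))"
    for n :: nat and st st' :: "real \<times> real \<times> real \<times> (rat \<Rightarrow> real)"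
  have "\<exists>st. \<forall>n. P n (st n) \<and> R n (st n) (st (Suc n))"
  proof (rule dependent_nat_choice[of P R])
    show "\<exists>st. P 0 st"
      by (rule exI[of _ "(1, 1, 0, \<lambda>_. 1)"]) (simp add: P_def one)
  next
    fix st n assume "P n st"
    moreover obtain p q a b where st: "st = (p, q, a, b)" by (cases st)
    ultimately have p: "0 < p" and b: "\<And>v. 0 < b v" by (auto simp: P_def)
    define m where "m = min p (min (1 / Suc n) (b (task n)))"
    have "0 < m" using p b[of "task n"] by (simp add: m_def)
    then obtain p' where "0 < p'" "p' < m" "\<phi> p' = task n - 2 ^ n"
      using dense[of 0 m "task n - 2 ^ n"] by blast
    then have p': "0 < p'" "p' < p" "p' < 1 / Suc n" "p' < b (task n)" "\<phi> p' = task n - 2 ^ n"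
      by (auto simp only: m_def min_less_iff_conj)
    have "p' / 2 < p'" using p' by simp
    then obtain q' where q': "p' / 2 < q'" "q' < p'" "\<phi> q' = 0"
      using dense[of "p' / 2" p' 0] by blast
    define a' where "a' = b (task n) - p'"
    define b' where "b' = (\<lambda>v. if v - task n \<in> pow2Z (Suc n) then p'
        else if v - 2 ^ n \<in> pow2Z (Suc n) then a' + q' else b v)"
    have "P (Suc n) (p', q', a', b')" using p' q' b by (simp add: P_def a'_def b'_def)
    moreover have "R n st (p', q', a', b')" using p' by (simp add: R_def st b'_def) (simp add: a'_def)
    ultimately show "\<exists>st'. P (Suc n) st' \<and> R n st st'" by blast
  qed
  then obtain st where P: "\<And>n. P n (st n)" and R: "\<And>n. R n (st n) (st (Suc n))" by blast
  define p q a b where "p n = fst (st n)" and "q n = fst (snd (st n))"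
    and "a n = fst (snd (snd (st n)))" and "b n = snd (snd (snd (st n)))" for n
  have st: "st n = (p n, q n, a n, b n)" for n by (simp add: p_def q_def a_def b_def)
  have "stages \<phi> p q a b"
  proof
    fix x y l r :: real and n :: nat and v :: rat
    show "\<phi> (x + y) = \<phi> x + \<phi> y" by (rule add)
    show "l < r \<Longrightarrow> \<exists>x. l < x \<and> x < r \<and> \<phi> x = v" by (rule dense)
    show "p 0 = 1" "q 0 = 1" "b 0 v = 1" using P[of 0] unfolding P_def st by simp_all
    show "\<phi> (q n) = 0" "0 < p n" "q n \<le> p n" "p n \<le> 2 * q n"
      using P[of n] unfolding P_def st by simp_all
    from R[of n] have "\<phi> (p (Suc n)) = task n - 2 ^ n \<and> p (Suc n) \<le> p n \<and> p (Suc n) < 1 / Suc n \<and>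
        p (Suc n) < b n (task n) \<and> a (Suc n) = b n (task n) - p (Suc n) \<and>
        b (Suc n) = (\<lambda>v. if v - task n \<in> pow2Z (Suc n) then p (Suc n)
          else if v - 2 ^ n \<in> pow2Z (Suc n) then a (Suc n) + q (Suc n) else b n v)"
      unfolding R_def st prod.case .
    then show "\<phi> (p (Suc n)) = task n - 2 ^ n" "p (Suc n) \<le> p n" "p (Suc n) < 1 / Suc n"
      "p (Suc n) < b n (task n)" "a (Suc n) = b n (task n) - p (Suc n)"
      "b (Suc n) v = (if v - task n \<in> pow2Z (Suc n) then p (Suc n)
         else if v - 2 ^ n \<in> pow2Z (Suc n) then a (Suc n) + q (Suc n) else b n v)"
      by (elim conjE; simp only:)+
  qed
  then show ?thesis by blast
qed

context stages
begin

lemma \<phi>_diff: "\<phi> (x - y) = \<phi> x - \<phi> y"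
  using add[of "x - y" y] by simp

lemma q_pos: "0 < q n"
  using p_pos[of n] q_ge[of n] by simp

lemma p_antimono: "m \<le> n \<Longrightarrow> p n \<le> p m"
  by (rule lift_Suc_antimono_le[of p]) (use p_le in auto)

lemma a_pos: "0 < a (Suc n)"
  using p_less[of n] by (simp add: a_Suc)

lemma b_pos: "0 < b n v"
  using a_pos q_pos p_pos by (induction n) (auto simp: b0 b_Suc intro: add_pos_pos)

definition shift :: "real \<Rightarrow> real"
  where "shift x = (if \<phi> x = 0 then 0
     else let n = level (\<phi> x) in if x \<le> a n then p n else q n)"

definition f :: "real \<Rightarrow> real"
  where "f x = x + shift x"

lemma shift_bounds: "\<phi> x \<noteq> 0 \<Longrightarrow> q (level (\<phi> x)) \<le> shift x \<and> shift x \<le> p (level (\<phi> x))"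
  using q_le by (auto simp: shift_def Let_def)

lemma shift_nonneg: "0 \<le> shift x"
  using p_pos q_pos by (simp add: shift_def Let_def less_imp_le)

lemma shift_le_1: "shift x \<le> 1"
  using shift_bounds[of x] p_antimono[of 0 "level (\<phi> x)"] p0 by (cases "\<phi> x = 0") (auto simp: shift_def)

lemma shift_antimono:
  assumes "x \<le> z" "\<phi> z = 0 \<longleftrightarrow> \<phi> x = 0" "level (\<phi> z) = level (\<phi> x)"
  shows "shift z \<le> shift x"
  using assms q_le by (auto simp: shift_def Let_def)

text \<open>
  The shift is antitone within one level, which settles all cases where \<open>x + y\<close> has the level of
  \<open>x\<close> or of \<open>y\<close>. When the levels of \<open>x\<close> and \<open>y\<close> agree, \<open>p \<le> 2 * q\<close> and the monotonicity of \<open>p\<close> take over.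
\<close>

lemma shift_subadditive:
  assumes "0 < x" "0 < y"
  shows "shift (x + y) \<le> shift x + shift y"
proof -
  have *: "shift (x + y) \<le> shift x + shift y"
    if "0 < x" "0 < y" "\<phi> x \<noteq> 0" "\<phi> y \<noteq> 0" "level (\<phi> x) \<le> level (\<phi> y)" for x y
  proof (cases "level (\<phi> x) < level (\<phi> y)")
    case True
    then have "shift (x + y) \<le> shift x"
      using that level_sum_eq[of "\<phi> x" "\<phi> y"] by (intro shift_antimono) (auto simp: add)
    then show ?thesis using shift_nonneg[of y] by simp
  next
    case False
    then have lev: "level (\<phi> y) = level (\<phi> x)" using that by simp
    show ?thesis
    proof (cases "\<phi> (x + y) = 0")
      case True
      then show ?thesis using shift_nonneg[of x] shift_nonneg[of y] by (simp add: shift_def)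
    next
      case nz: False
      then have "level (\<phi> x) \<le> level (\<phi> (x + y))"
        using level_sum_ge[of "\<phi> x" "\<phi> y"] that by (simp add: add)
      then have "shift (x + y) \<le> p (level (\<phi> x))"
        using shift_bounds[OF nz] p_antimono order_trans by blast
      also have "\<dots> \<le> shift x + shift y"
        using q_ge[of "level (\<phi> x)"] shift_bounds[of x] shift_bounds[of y] that lev by simp
      finally show ?thesis .
    qed
  qed
  consider "\<phi> x = 0" | "\<phi> y = 0" | "\<phi> x \<noteq> 0" "\<phi> y \<noteq> 0" by blast
  then show ?thesis
  proof cases
    case 1
    then have "shift (x + y) \<le> shift y" using assms by (intro shift_antimono) (auto simp: add)
    then show ?thesis using shift_nonneg[of x] by simp
  next
    case 2
    then have "shift (x + y) \<le> shift x" using assms by (intro shift_antimono) (auto simp: add)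
    then show ?thesis using shift_nonneg[of y] by simp
  next
    case 3
    then show ?thesis
      using *[of x y] *[of y x] assms by (metis add.commute nle_le)
  qed
qed

text \<open>
  Stage \<open>n\<close> works with whole cosets of the subgroup with index \<open>n + 1\<close>, so later and finer
  stages still see constant thresholds on their own cosets.
\<close>

lemma b_cong: "v - w \<in> pow2Z n \<Longrightarrow> b n v = b n w"
proof (induction n)
  case 0
  then show ?case by (simp add: b0)
next
  case (Suc n)
  have "v - u \<in> pow2Z (Suc n) \<longleftrightarrow> w - u \<in> pow2Z (Suc n)" for u
    using Suc.prems pow2Z_cong[of "v - u" "w - u" "Suc n"] by simp
  moreover have "b n v = b n w" using Suc by (blast intro: pow2Z_Suc_subset)
  ultimately show ?case by (simp add: b_Suc)
qed

lemma bij_betw_translation: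
  assumes "\<phi> c = w - v"
  shows "bij_betw (\<lambda>x. x + c) {x. P (x + c) \<and> \<phi> x - v \<in> pow2Z n} {y. P y \<and> \<phi> y - w \<in> pow2Z n}"
  by (rule bij_betw_byWitness[where f' = "\<lambda>y. y - c"]) (auto simp: assms add \<phi>_diff algebra_simps)

text \<open>
  In the induction step the new layer splits at \<open>A\<close>. Its lower part fills the gap below the
  threshold in the class of the task \<open>w\<close>, and its upper part returns to the layer. The threshold
  is the same on this entire class because the class is finer than those used before.
\<close>

lemma bij_betw_f_stage:
  "bij_betw f {x. 0 < x \<and> \<phi> x \<notin> pow2Z n} {y. b n (\<phi> y) < y \<and> \<phi> y \<notin> pow2Z n}"
proof (induction n)
  case 0
  have "bij_betw (\<lambda>x. x + 1) {x. 0 < x \<and> \<phi> x \<notin> pow2Z 0} {y. 1 < y \<and> \<phi> y \<notin> pow2Z 0}"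
    using \<phi>_q[of 0]
    by (intro bij_betw_byWitness[where f' = "\<lambda>y. y - 1"]) (auto simp: add \<phi>_diff q0)
  moreover have "f x = x + 1" if "\<phi> x \<notin> pow2Z 0" for x
  proof -
    have "\<phi> x \<noteq> 0" using that zero_in_pow2Z by metis
    then have "level (\<phi> x) = 0" using that level_le_iff[of "\<phi> x" 0] by simp
    with \<open>\<phi> x \<noteq> 0\<close> show ?thesis by (simp add: f_def shift_def p0 q0)
  qed
  ultimately show ?case
    by (subst bij_betw_cong[where g = "\<lambda>x. x + 1"]) (auto simp: b0)
next
  case (Suc n)
  define w where "w = task n"
  define P Q A where "P = p (Suc n)" and "Q = q (Suc n)" and "A = a (Suc n)"
  define lo hi where "lo = {x. (0 < x \<and> x \<le> A) \<and> \<phi> x - 2 ^ n \<in> pow2Z (Suc n)}"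
    and "hi = {x. A < x \<and> \<phi> x - 2 ^ n \<in> pow2Z (Suc n)}"
  define lo' hi' where "lo' = {y. (P < y \<and> y \<le> b n w) \<and> \<phi> y - w \<in> pow2Z (Suc n)}"
    and "hi' = {y. A + Q < y \<and> \<phi> y - 2 ^ n \<in> pow2Z (Suc n)}"
  define old old' where "old = {x. 0 < x \<and> \<phi> x \<notin> pow2Z n}"
    and "old' = {y. b n (\<phi> y) < y \<and> \<phi> y \<notin> pow2Z n}"
  have A: "0 < A" "b n w = A + P" using a_pos[of n] by (auto simp: A_def a_Suc P_def w_def)
  have w: "w \<notin> pow2Z n" unfolding w_def by (rule task_notin_pow2Z)
  have layer: "v \<in> pow2Z n" "v \<notin> pow2Z (Suc n)" if "v - 2 ^ n \<in> pow2Z (Suc n)" for v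
    using that pow2Z_layer_iff by auto
  have near_w: "v \<notin> pow2Z n" "b n v = b n w" if "v - w \<in> pow2Z (Suc n)" for v
    using that pow2Z_cong[of v w n] w b_cong pow2Z_Suc_subset by blast+
  have f_eq: "f x = x + (if x \<le> A then P else Q)" if "\<phi> x - 2 ^ n \<in> pow2Z (Suc n)" for x
    using level_eq_Suc[OF that] by (simp add: f_def shift_def A_def P_def Q_def)
  have "{x. (P < x + P \<and> x + P \<le> b n w) \<and> \<phi> x - 2 ^ n \<in> pow2Z (Suc n)} = lo"
    by (auto simp: lo_def A)
  then have "bij_betw (\<lambda>x. x + P) lo lo'"
    using bij_betw_translation[of P w "2 ^ n" "\<lambda>y. P < y \<and> y \<le> b n w" "Suc n"] \<phi>_p[of n]
    by (simp add: lo'_def P_def w_def)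
  then have lo: "bij_betw f lo lo'"
    by (subst bij_betw_cong[where g = "\<lambda>x. x + P"]) (auto simp: lo_def f_eq)
  have "bij_betw (\<lambda>x. x + Q) hi hi'"
    using bij_betw_translation[of Q "2 ^ n" "2 ^ n" "\<lambda>y. A + Q < y"] \<phi>_q[of "Suc n"]
    by (simp add: hi_def hi'_def Q_def)
  then have hi: "bij_betw f hi hi'"
    by (subst bij_betw_cong[where g = "\<lambda>x. x + Q"]) (auto simp: hi_def f_eq)
  have old: "bij_betw f old old'" using Suc.IH by (simp add: old_def old'_def)
  have "bij_betw f (old \<union> lo) (old' \<union> lo')"
    using near_w by (intro bij_betw_combine old lo) (auto simp: old'_def lo'_def)
  moreover have "(old' \<union> lo') \<inter> hi' = {}"
    using near_w layer by (auto simp: old'_def lo'_def hi'_def)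
  ultimately have "bij_betw f (old \<union> lo \<union> hi) (old' \<union> lo' \<union> hi')"
    using hi by (intro bij_betw_combine[of f "old \<union> lo"])
  moreover have "old \<union> lo \<union> hi = {x. 0 < x \<and> \<phi> x \<notin> pow2Z (Suc n)}"
    using A layer pow2Z_layer_iff pow2Z_Suc_subset by (fastforce simp: old_def lo_def hi_def)
  moreover have "old' \<union> lo' \<union> hi' = {y. b (Suc n) (\<phi> y) < y \<and> \<phi> y \<notin> pow2Z (Suc n)}"
  proof (intro set_eqI)
    fix y
    consider (w) "\<phi> y - w \<in> pow2Z (Suc n)" | (layer) "\<phi> y - w \<notin> pow2Z (Suc n)" "\<phi> y - 2 ^ n \<in> pow2Z (Suc n)"
      | (other) "\<phi> y - w \<notin> pow2Z (Suc n)" "\<phi> y - 2 ^ n \<notin> pow2Z (Suc n)" by blast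
    then show "y \<in> old' \<union> lo' \<union> hi' \<longleftrightarrow> y \<in> {y. b (Suc n) (\<phi> y) < y \<and> \<phi> y \<notin> pow2Z (Suc n)}"
    proof cases
      case w
      then have "b (Suc n) (\<phi> y) = P" by (simp add: b_Suc w_def P_def)
      then show ?thesis using w near_w[OF w] layer[of "\<phi> y"] pow2Z_Suc_subset[of "\<phi> y"] A
        by (auto simp: old'_def lo'_def hi'_def)
    next
      case layer
      then have "b (Suc n) (\<phi> y) = A + Q" by (simp add: b_Suc w_def A_def Q_def)
      then show ?thesis using layer pow2Z_layer_iff[of "\<phi> y" n]
        by (auto simp: old'_def lo'_def hi'_def)
    next
      case other
      then have "b (Suc n) (\<phi> y) = b n (\<phi> y)" by (simp add: b_Suc w_def)
      then show ?thesis using other pow2Z_layer_iff[of "\<phi> y" n] pow2Z_Suc_subset[of "\<phi> y" n]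
        by (auto simp: old'_def lo'_def hi'_def)
    qed
  qed
  ultimately show ?case by simp
qed

text \<open>After a stage with task \<open>v\<close> the threshold of \<open>v\<close> is the current \<open>p\<close>, and these tend to 0.\<close>

lemma eventually_covered:
  assumes "0 < y" "v \<noteq> 0"
  shows "\<exists>n. b n v < y \<and> v \<notin> pow2Z n"
proof -
  obtain N where N: "1 / real (Suc N) < y" using assms nat_approx_posE by blast
  obtain n where n: "N \<le> n" "task n = v" using task_recurs assms by blast
  have "b (Suc n) v = p (Suc n)" using n by (simp add: b_Suc zero_in_pow2Z)
  also have "\<dots> < 1 / Suc n" by (rule p_small)
  also have "\<dots> \<le> 1 / Suc N" using n by (simp add: field_simps)
  finally have "b (Suc n) v < y" using N by simp
  moreover have "v \<notin> pow2Z (Suc n)" using n task_notin_pow2Z pow2Z_Suc_subset by blast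
  ultimately show ?thesis by blast
qed

lemma bij_betw_f: "bij_betw f {0<..} {0<..}"
proof -
  \<comment> \<open>any two points are treated within one common stage, so injectivity passes to the union\<close>
  have chain: "\<exists>n. \<phi> x \<notin> pow2Z n \<and> \<phi> z \<notin> pow2Z n" if "\<phi> x \<noteq> 0" "\<phi> z \<noteq> 0" for x z
    using that by (metis level_le_iff nle_le)
  have inj: "inj_on f {x. 0 < x \<and> \<phi> x \<noteq> 0}"
  proof (rule inj_onI)
    fix x z assume xz: "x \<in> {x. 0 < x \<and> \<phi> x \<noteq> 0}" "z \<in> {x. 0 < x \<and> \<phi> x \<noteq> 0}" "f x = f z"
    then obtain n where "\<phi> x \<notin> pow2Z n" "\<phi> z \<notin> pow2Z n" using chain by blast
    with xz show "x = z"
      using inj_onD[OF bij_betw_imp_inj_on[OF bij_betw_f_stage[of n]]] by simp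
  qed
  have "f ` {x. 0 < x \<and> \<phi> x \<noteq> 0} = {y. 0 < y \<and> \<phi> y \<noteq> 0}"
  proof (intro set_eqI iffI)
    fix y assume "y \<in> f ` {x. 0 < x \<and> \<phi> x \<noteq> 0}"
    then obtain x where x: "0 < x" "\<phi> x \<noteq> 0" "y = f x" by blast
    then obtain n where "\<phi> x \<notin> pow2Z n" using chain by blast
    then have "b n (\<phi> y) < y \<and> \<phi> y \<notin> pow2Z n"
      using bij_betw_apply[OF bij_betw_f_stage[of n], of x] x by simp
    then show "y \<in> {y. 0 < y \<and> \<phi> y \<noteq> 0}"
      using b_pos[of n "\<phi> y"] zero_in_pow2Z[of n] by auto
  next
    fix y assume "y \<in> {y. 0 < y \<and> \<phi> y \<noteq> 0}"
    then obtain n where "b n (\<phi> y) < y \<and> \<phi> y \<notin> pow2Z n" using eventually_covered by blast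
    then obtain x where "0 < x" "\<phi> x \<notin> pow2Z n" "y = f x"
      using bij_betw_imp_surj_on[OF bij_betw_f_stage[of n]] by blast
    then show "y \<in> f ` {x. 0 < x \<and> \<phi> x \<noteq> 0}" using zero_in_pow2Z[of n] by force
  qed
  with inj have "bij_betw f {x. 0 < x \<and> \<phi> x \<noteq> 0} {y. 0 < y \<and> \<phi> y \<noteq> 0}"
    by (simp add: bij_betw_def)
  moreover have "bij_betw f {x. 0 < x \<and> \<phi> x = 0} {y. 0 < y \<and> \<phi> y = 0}"
    by (subst bij_betw_cong[where g = id]) (auto simp: f_def shift_def)
  ultimately have "bij_betw f ({x. 0 < x \<and> \<phi> x \<noteq> 0} \<union> {x. 0 < x \<and> \<phi> x = 0})
      ({y. 0 < y \<and> \<phi> y \<noteq> 0} \<union> {y. 0 < y \<and> \<phi> y = 0})"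
    by (intro bij_betw_combine) auto
  moreover have "{x. 0 < x \<and> \<phi> x \<noteq> 0} \<union> {x. 0 < x \<and> \<phi> x = 0} = {0<..}" by auto
  ultimately show ?thesis by simp
qed

lemma f_subadditive: "0 < x \<Longrightarrow> 0 < y \<Longrightarrow> f (x + y) \<le> f x + f y"
  using shift_subadditive[of x y] by (simp add: f_def)

lemma Liminf_f: "Liminf (at_right 0) (\<lambda>x. ereal (f x)) = 0"
proof (rule antisym)
  show "0 \<le> Liminf (at_right 0) (\<lambda>x. ereal (f x))"
    using shift_nonneg by (intro Liminf_bounded) (auto simp: f_def eventually_at_right_field intro!: exI[of _ 1] add_nonneg_nonneg)
  show "Liminf (at_right 0) (\<lambda>x. ereal (f x)) \<le> 0"
  proof (rule ccontr)
    assume "\<not> ?thesis"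
    then obtain c where c: "0 < ereal c" "ereal c < Liminf (at_right 0) (\<lambda>x. ereal (f x))"
      using ereal_dense2 by (metis not_le)
    then have "\<forall>\<^sub>F x in at_right 0. c < f x" using less_LiminfD by fastforce
    then obtain \<delta> where d: "\<delta> > 0" "\<And>x. 0 < x \<Longrightarrow> x < \<delta> \<Longrightarrow> c < f x"
      by (auto simp: eventually_at_right_field)
    obtain x where "0 < x" "x < min c \<delta>" "\<phi> x = 0" using dense[of 0 "min c \<delta>" 0] c d by auto
    with d(2)[of x] show False by (simp add: f_def shift_def)
  qed
qed

lemma Limsup_f: "Limsup (at_right 0) (\<lambda>x. ereal (f x)) = 1"
proof (rule antisym)
  have "((\<lambda>x. ereal (1 + x)) \<longlongrightarrow> ereal (1 + 0)) (at_right 0)"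
    by (intro tendsto_intros)
  then have "Limsup (at_right 0) (\<lambda>x. ereal (1 + x)) = 1"
    using lim_imp_Limsup by (force simp: one_ereal_def)
  moreover have "Limsup (at_right 0) (\<lambda>x. ereal (f x)) \<le> Limsup (at_right 0) (\<lambda>x. ereal (1 + x))"
    using shift_le_1 by (intro Limsup_mono) (simp add: f_def)
  ultimately show "Limsup (at_right 0) (\<lambda>x. ereal (f x)) \<le> 1" by simp
  show "1 \<le> Limsup (at_right 0) (\<lambda>x. ereal (f x))"
  proof (rule ccontr)
    assume "\<not> ?thesis"
    then have "\<forall>\<^sub>F x in at_right 0. ereal (f x) < 1" by (intro Limsup_lessD) simp
    then obtain \<delta> where d: "\<delta> > 0" "\<And>x. 0 < x \<Longrightarrow> x < \<delta> \<Longrightarrow> f x < 1"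
      by (auto simp: eventually_at_right_field)
    obtain x where x: "0 < x" "x < \<delta>" "\<phi> x = 1 / 2" using dense[of 0 \<delta> "1 / 2"] d by auto
    have "level (\<phi> x) = 0" using half_notin_pow2Z[of 0] level_le_iff[of "1 / 2" 0] unfolding x(3) by simp
    moreover have "\<phi> x \<noteq> 0" using x by simp
    ultimately have "f x = x + 1" by (simp add: f_def shift_def p0 q0)
    with d(2)[of x] x show False by simp
  qed
qed

end

theorem theorem1p2:
  shows "\<exists>f :: real \<Rightarrow> real.
    bij_betw f {0<..} {0<..} \<and>
    (\<forall>x>0. \<forall>y>0. f (x + y) \<le> f x + f y) \<and>
    Liminf (at_right 0) (\<lambda>x. ereal (f x)) = 0 \<and>
    Limsup (at_right 0) (\<lambda>x. ereal (f x)) = 1"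
proof -
  obtain \<phi> :: "real \<Rightarrow> rat" where "\<And>x y. \<phi> (x + y) = \<phi> x + \<phi> y" "\<phi> 1 = 0"
    "\<And>v l r. l < r \<Longrightarrow> \<exists>x. l < x \<and> x < r \<and> \<phi> x = v"
    using additive_functional_exists by blast
  then obtain p q a b where "stages \<phi> p q a b" using stages_exist by blast
  then interpret stages \<phi> p q a b .
  show ?thesis using bij_betw_f f_subadditive Liminf_f Limsup_f by blast
qed

end
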